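(* There exists $R_0$ such that the following holds. Let $q\ge 1$ and $r$ be integers with $R_0\le r\le 0.01q$, and let $n=q^2+q+1-r$ (so $n\in\{q^2+1,\dots,q^2+q\}$). Then $$\mathrm{ex}(n,C_4)=\mathrm{ex}(q^2+q+1-r,C_4)\le \frac12 q(q+1)^2-0.92\,rq.$$
   Context: $\mathrm{ex}(n,C_4)$ denotes the maximum number of edges in an $n$-vertex simple graph containing no cycle of length four as a subgraph. *)

theory Defs
  imports Complex_Main
begin

definition simple_graph :: "'a set \<Rightarrow> 'a set set \<Rightarrow> bool" where
  "simple_graph V E \<longleftrightarrow> finite V \<and> (\<forall>e\<in>E. e \<subseteq> V \<and> card e = 2)"

text \<open>A four-cycle as a not necessarily induced subgraph: the diagonals
  \<open>{a, c}\<close> and \<open>{b, d}\<close> may or may not be edges.\<close>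

definition contains_C4 :: "'a set set \<Rightarrow> bool" where
  "contains_C4 E \<longleftrightarrow>
     (\<exists>a b c d. distinct [a, b, c, d] \<and>
        {a, b} \<in> E \<and> {b, c} \<in> E \<and> {c, d} \<in> E \<and> {d, a} \<in> E)"

text \<open>Taking the vertices to be natural numbers loses no generality, and the maximum is over a
  finite nonempty set; see \<open>card_le_ex_C4\<close> and \<open>ex_C4_attained\<close> below.\<close>

definition ex_C4 :: "nat \<Rightarrow> nat" where
  "ex_C4 n = Max {card E | (V :: nat set) E.
     simple_graph V E \<and> card V = n \<and> \<not> contains_C4 E}"

lemma simple_graph_finite_edges: "simple_graph V E \<Longrightarrow> finite E"
  unfolding simple_graph_def by (meson PowI finite_Pow_iff finite_subset subsetI)

lemma simple_graph_card_edges: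
  assumes "simple_graph V E"
  shows "card E \<le> card V choose 2"
proof -
  have fin: "finite V" and sub: "E \<subseteq> {e. e \<subseteq> V \<and> card e = 2}"
    using assms unfolding simple_graph_def by auto
  from fin have "finite {e. e \<subseteq> V \<and> card e = 2}" by simp
  then have "card E \<le> card {e. e \<subseteq> V \<and> card e = 2}" using sub by (rule card_mono)
  then show ?thesis using n_subsets[OF fin] by simp
qed

lemma finite_C4_free_sizes:
  "finite {card E | (V :: 'a set) E. simple_graph V E \<and> card V = n \<and> \<not> contains_C4 E}"
  by (rule finite_subset[of _ "{..n choose 2}"]) (auto dest: simple_graph_card_edges)

lemma ex_C4_attained:
  "\<exists>(V :: nat set) E. simple_graph V E \<and> card V = n \<and> \<not> contains_C4 E \<and> card E = ex_C4 n"
proof -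
  let ?S = "{card E | (V :: nat set) E. simple_graph V E \<and> card V = n \<and> \<not> contains_C4 E}"
  have "simple_graph {..<n} {} \<and> card {..<n} = n \<and> \<not> contains_C4 ({} :: nat set set)"
    by (simp add: simple_graph_def contains_C4_def)
  then have "card ({} :: nat set set) \<in> ?S" by blast
  then have "?S \<noteq> {}" by blast
  then have "Max ?S \<in> ?S" by (rule Max_in[OF finite_C4_free_sizes])
  then have "ex_C4 n \<in> ?S" by (simp only: ex_C4_def)
  then show ?thesis by (auto simp: eq_commute)
qed

lemma card_le_ex_C4:
  fixes V :: "'a set"
  assumes G: "simple_graph V E" and free: "\<not> contains_C4 E"
  shows "card E \<le> ex_C4 (card V)"
proof -
  have fin: "finite V" and sub: "\<And>e. e \<in> E \<Longrightarrow> e \<subseteq> V \<and> card e = 2"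
    using G unfolding simple_graph_def by auto
  obtain f :: "'a \<Rightarrow> nat" where inj: "inj_on f V"
    using finite_imp_inj_to_nat_seg[OF fin] by blast
  let ?E = "(`) f ` E"
  have injE: "inj_on ((`) f) E"
    using inj_on_image_Pow[OF inj] by (rule inj_on_subset) (use sub in auto)
  have "simple_graph (f ` V) ?E"
    unfolding simple_graph_def
  proof (intro conjI ballI)
    fix e' assume "e' \<in> ?E"
    then obtain e where e: "e \<in> E" "e' = f ` e" by blast
    then show "e' \<subseteq> f ` V" using sub[OF e(1)] by blast
    show "card e' = 2"
      using card_image[OF inj_on_subset[OF inj, of e]] sub[OF e(1)] e(2) by simp
  qed (use fin in simp)
  moreover have "\<not> contains_C4 ?E"
  proof
    assume "contains_C4 ?E"
    then obtain a b c d where dist: "distinct [a, b, c, d]"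
      and "{a, b} \<in> ?E" "{b, c} \<in> ?E" "{c, d} \<in> ?E" "{d, a} \<in> ?E"
      unfolding contains_C4_def by blast
    then obtain e1 e2 e3 e4 where e: "e1 \<in> E" "e2 \<in> E" "e3 \<in> E" "e4 \<in> E"
      "{a, b} = f ` e1" "{b, c} = f ` e2" "{c, d} = f ` e3" "{d, a} = f ` e4" by auto
    have "a \<in> f ` V" "b \<in> f ` V" "c \<in> f ` V" "d \<in> f ` V"
      using sub[OF e(1)] sub[OF e(3)] e(5,7) by (metis image_mono insert_subset)+
    then obtain a' b' c' d' where v: "a' \<in> V" "b' \<in> V" "c' \<in> V" "d' \<in> V"
      and fv: "a = f a'" "b = f b'" "c = f c'" "d = f d'" by blast
    have pull: "{x, y} \<in> E" if "e \<in> E" "{f x, f y} = f ` e" "x \<in> V" "y \<in> V" for x y e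
    proof -
      have "f ` {x, y} = f ` e" using that(2) by simp
      then have "{x, y} = e"
        using inj_on_image_eq_iff[OF inj, of "{x, y}" e] that(3,4) sub[OF that(1)] by blast
      then show ?thesis using that(1) by simp
    qed
    note e' = e[unfolded fv]
    have "{a', b'} \<in> E" "{b', c'} \<in> E" "{c', d'} \<in> E" "{d', a'} \<in> E"
      using pull[OF e'(1,5) v(1,2)] pull[OF e'(2,6) v(2,3)]
        pull[OF e'(3,7) v(3,4)] pull[OF e'(4,8) v(4,1)] .
    moreover have "distinct [a', b', c', d']" using dist unfolding fv by auto
    ultimately show False using free unfolding contains_C4_def by blast
  qed
  moreover have "card (f ` V) = card V" by (rule card_image[OF inj])
  ultimately have "card ?E \<in> {card E | (V' :: nat set) E.
     simple_graph V' E \<and> card V' = card V \<and> \<not> contains_C4 E}" by blast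
  then have "card ?E \<le> ex_C4 (card V)"
    unfolding ex_C4_def by (rule Max_ge[OF finite_C4_free_sizes])
  then show ?thesis using card_image[OF injE] by simp
qed

end

theory Submission
  imports Defs "HOL-Analysis.Convex"
begin

text \<open>
  Let \<open>\<delta>(v) = q + 1 - d(v)\<close> be the deficiency of \<open>v\<close>, with positive part \<open>w\<close> and negative part \<open>x\<close>, and
  let \<open>B = {\<delta> > 0}\<close>. Counting the paths of length two from \<open>v\<close> shows that the neighbours of \<open>v\<close>
  have total deficiency at least \<open>r - q \<delta>(v)\<close>. Summed over \<open>V - B\<close>, this gives
  \<open>q \<Sum>\<delta> \<ge> r (n - card B)\<close>, so a graph with too many edges has \<open>card B \<ge> 0.15 q\<^sup>2\<close>.
  On the other hand every \<open>v\<close> sees at least \<open>q x(v)\<close> of the weight \<open>w\<close>, and as codegrees are at most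
  one, the second moment of the weight seen is at most \<open>(\<Sum>w)\<^sup>2 + q \<Sum>w\<^sup>2\<close>. As \<open>x\<close> lives on \<open>V - B\<close>,
  Cauchy-Schwarz turns this into \<open>\<Sum>x\<^sup>2 = O(r q)\<close>, which makes \<open>card B \<le> \<Sum>w = \<Sum>\<delta> + \<Sum>x\<close> too small.
\<close>

section \<open>Neighbourhoods, codegrees and deficiency in a graph without four-cycles\<close>

locale C4_free_graph =
  fixes V :: "'a set" and E :: "'a set set"
  assumes simple: "simple_graph V E" and C4_free: "\<not> contains_C4 E"
begin

definition nbrs :: "'a \<Rightarrow> 'a set" where
  "nbrs v = {u. {v, u} \<in> E}"

lemma finite_V: "finite V"
  using simple by (simp add: simple_graph_def)

lemma edgeD: "e \<in> E \<Longrightarrow> e \<subseteq> V \<and> card e = 2"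
  using simple by (auto simp: simple_graph_def)

lemma nbrs_subset: "nbrs v \<subseteq> V"
  using edgeD by (auto simp: nbrs_def)

lemma finite_nbrs [simp]: "finite (nbrs v)"
  using nbrs_subset finite_V by (rule finite_subset)

lemma nbrs_sym: "u \<in> nbrs v \<longleftrightarrow> v \<in> nbrs u"
  by (simp add: nbrs_def insert_commute)

lemma not_in_nbrs_self: "v \<notin> nbrs v"
  using edgeD[of "{v}"] by (auto simp: nbrs_def)

text \<open>Two common neighbours \<open>a\<close>, \<open>b\<close> would close the four-cycle
  \<open>u\<close>, \<open>a\<close>, \<open>v\<close>, \<open>b\<close>. All later uses of
  C4-freeness pass through this fact.\<close>

lemma common_nbrs_unique:
  assumes "u \<noteq> v" "a \<in> nbrs u \<inter> nbrs v" "b \<in> nbrs u \<inter> nbrs v"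
  shows "a = b"
proof (rule ccontr)
  assume "a \<noteq> b"
  moreover have "a \<noteq> u" "a \<noteq> v" "b \<noteq> u" "b \<noteq> v"
    using assms not_in_nbrs_self by auto
  ultimately have "distinct [u, a, v, b]" using assms(1) by auto
  moreover have "{u, a} \<in> E" "{a, v} \<in> E" "{v, b} \<in> E" "{b, u} \<in> E"
    using assms by (auto simp: nbrs_def insert_commute)
  ultimately show False using C4_free unfolding contains_C4_def by blast
qed

lemma card_common_nbrs_le: "u \<noteq> v \<Longrightarrow> card (nbrs u \<inter> nbrs v) \<le> 1"
  using common_nbrs_unique[of u v] by (auto simp: card_le_Suc0_iff_eq)

lemma sum_nbrs_swap:
  fixes f :: "'a \<Rightarrow> 'a \<Rightarrow> 'b::comm_monoid_add"
  shows "(\<Sum>v\<in>V. \<Sum>u\<in>nbrs v. f v u) = (\<Sum>u\<in>V. \<Sum>v\<in>nbrs u. f v u)"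
proof -
  have nbrs_eq: "{u \<in> V. u \<in> nbrs v} = nbrs v" "{u \<in> V. v \<in> nbrs u} = nbrs v" for v
    using nbrs_subset by (auto simp: nbrs_sym[of v])
  show ?thesis
    using sum.swap_restrict[OF finite_V finite_V, of f "\<lambda>v u. u \<in> nbrs v"]
    by (simp add: nbrs_eq)
qed

lemma sum_nbrs_eq_degree_sum:
  fixes f :: "'a \<Rightarrow> real"
  shows "(\<Sum>v\<in>V. \<Sum>u\<in>nbrs v. f u) = (\<Sum>u\<in>V. real (card (nbrs u)) * f u)"
  by (subst sum_nbrs_swap) simp

lemma handshake: "(\<Sum>v\<in>V. card (nbrs v)) = 2 * card E"
proof -
  have "card (nbrs v) = card {e \<in> E. v \<in> e}" for v
  proof (rule bij_betw_same_card, rule bij_betw_imageI)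
    show "inj_on (\<lambda>u. {v, u}) (nbrs v)"
      by (auto simp: inj_on_def doubleton_eq_iff)
    show "(\<lambda>u. {v, u}) ` nbrs v = {e \<in> E. v \<in> e}"
    proof (intro equalityI subsetI)
      fix e assume e: "e \<in> {e \<in> E. v \<in> e}"
      then obtain a b where "e = {a, b}" using edgeD card_2_iff by (metis (lifting) mem_Collect_eq)
      with e show "e \<in> (\<lambda>u. {v, u}) ` nbrs v"
        by (auto simp: nbrs_def insert_commute)
    qed (auto simp: nbrs_def)
  qed
  then have "(\<Sum>v\<in>V. card (nbrs v)) = (\<Sum>v\<in>V. card {e \<in> E. v \<in> e})" by simp
  also have "\<dots> = (\<Sum>e\<in>E. card {v \<in> V. v \<in> e})"
    using sum.swap_restrict[OF finite_V simple_graph_finite_edges[OF simple],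
        of "\<lambda>_ _. 1::nat" "\<lambda>v e. v \<in> e"] by simp
  also have "\<dots> = (\<Sum>e\<in>E. 2)"
  proof (rule sum.cong)
    fix e assume "e \<in> E"
    moreover from this have "{v \<in> V. v \<in> e} = e" using edgeD by auto
    ultimately show "card {v \<in> V. v \<in> e} = 2" using edgeD by simp
  qed simp
  finally show ?thesis by simp
qed

text \<open>The sets \<open>nbrs u - {v}\<close> for \<open>u\<close> in \<open>nbrs v\<close> are
  pairwise disjoint, since neighbours of \<open>v\<close> share only \<open>v\<close>, and they lie
  in \<open>V - {v}\<close>.\<close>

lemma two_paths_le:
  assumes "v \<in> V"
  shows "(\<Sum>u\<in>nbrs v. real (card (nbrs u)) - 1) \<le> real (card V) - 1"
proof -
  have pos: "card (nbrs u - {v}) + 1 = card (nbrs u)" if "u \<in> nbrs v" for u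
    using that card_Suc_Diff1[of "nbrs u" v] by (simp add: nbrs_sym)
  have "(\<Sum>u\<in>nbrs v. card (nbrs u - {v})) = card (\<Union>u\<in>nbrs v. nbrs u - {v})"
  proof (rule card_UN_disjoint[symmetric])
    show "\<forall>i\<in>nbrs v. \<forall>j\<in>nbrs v. i \<noteq> j \<longrightarrow> (nbrs i - {v}) \<inter> (nbrs j - {v}) = {}"
    proof (intro ballI impI)
      fix i j assume "i \<in> nbrs v" "j \<in> nbrs v" "i \<noteq> j"
      then have "v \<in> nbrs i \<inter> nbrs j" by (simp add: nbrs_sym)
      then show "(nbrs i - {v}) \<inter> (nbrs j - {v}) = {}"
        using common_nbrs_unique[OF \<open>i \<noteq> j\<close>, of _ v] by blast
    qed
  qed auto
  also have "\<dots> \<le> card (V - {v})"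
    using finite_V nbrs_subset by (intro card_mono) auto
  also have "\<dots> = card V - 1" using assms by simp
  finally have "(\<Sum>u\<in>nbrs v. card (nbrs u - {v})) + 1 \<le> card V"
    using card_gt_0_iff[of V] assms finite_V by auto
  then have "(\<Sum>u\<in>nbrs v. real (card (nbrs u - {v}))) + 1 \<le> real (card V)"
    by (simp flip: of_nat_sum)
  moreover have "real (card (nbrs u)) - 1 = real (card (nbrs u - {v}))" if "u \<in> nbrs v" for u
    using pos[OF that] by linarith
  ultimately show ?thesis by simp
qed

text \<open>Expanding the square weights each pair \<open>w a * w b\<close> by the codegree of
  \<open>a\<close> and \<open>b\<close>. Off the diagonal this is at most one; on the diagonal it is
  the degree.\<close>

lemma second_moment_le:
  fixes w :: "'a \<Rightarrow> real"
  assumes w: "\<And>v. w v \<ge> 0"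
  shows "(\<Sum>v\<in>V. (\<Sum>u\<in>nbrs v. w u)\<^sup>2)
    \<le> (\<Sum>v\<in>V. w v)\<^sup>2 + (\<Sum>v\<in>V. real (card (nbrs v)) * (w v)\<^sup>2)"
proof -
  have codegree: "(\<Sum>v\<in>nbrs a. \<Sum>b\<in>nbrs v. w b) = (\<Sum>b\<in>V. real (card (nbrs a \<inter> nbrs b)) * w b)" for a
  proof -
    have "(\<Sum>v\<in>nbrs a. \<Sum>b\<in>nbrs v. w b) = (\<Sum>v\<in>nbrs a. \<Sum>b\<in>{b\<in>V. v \<in> nbrs b}. w b)"
      using nbrs_subset by (intro sum.cong) (auto simp: nbrs_sym)
    also have "\<dots> = (\<Sum>b\<in>V. \<Sum>v\<in>{v \<in> nbrs a. v \<in> nbrs b}. w b)"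
      by (rule sum.swap_restrict) (auto simp: finite_V)
    finally show ?thesis by (simp add: Int_def)
  qed
  have "(\<Sum>v\<in>V. (\<Sum>u\<in>nbrs v. w u)\<^sup>2) = (\<Sum>v\<in>V. \<Sum>a\<in>nbrs v. w a * (\<Sum>b\<in>nbrs v. w b))"
    by (simp add: power2_eq_square sum_distrib_right)
  also have "\<dots> = (\<Sum>a\<in>V. \<Sum>v\<in>nbrs a. w a * (\<Sum>b\<in>nbrs v. w b))"
    by (rule sum_nbrs_swap)
  also have "\<dots> = (\<Sum>a\<in>V. \<Sum>b\<in>V. real (card (nbrs a \<inter> nbrs b)) * (w a * w b))"
    by (simp add: sum_distrib_left[symmetric] codegree) (simp add: sum_distrib_left mult_ac)
  also have "\<dots> \<le> (\<Sum>a\<in>V. \<Sum>b\<in>V. w a * w b + (if a = b then real (card (nbrs a)) * (w a)\<^sup>2 else 0))"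
  proof (intro sum_mono)
    fix a b
    show "real (card (nbrs a \<inter> nbrs b)) * (w a * w b)
        \<le> w a * w b + (if a = b then real (card (nbrs a)) * (w a)\<^sup>2 else 0)"
    proof (cases "a = b")
      case False
      then have "real (card (nbrs a \<inter> nbrs b)) \<le> 1" using card_common_nbrs_le by simp
      with False show ?thesis using w[of a] w[of b] by (simp add: mult_left_le_one_le)
    qed (simp add: power2_eq_square)
  qed
  also have "\<dots> = (\<Sum>v\<in>V. w v)\<^sup>2 + (\<Sum>v\<in>V. real (card (nbrs v)) * (w v)\<^sup>2)"
    by (simp add: sum.distrib finite_V power2_eq_square sum_product)
  finally show ?thesis .
qed

text \<open>The reference degree \<open>q + 1\<close> is the number of points on a line of a
  projective plane of order \<open>q\<close>. Values are signed because larger degrees may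
  occur.\<close>

definition deficiency :: "int \<Rightarrow> 'a \<Rightarrow> int" where
  "deficiency q v = q + 1 - int (card (nbrs v))"

lemma sum_deficiency: "(\<Sum>v\<in>V. deficiency q v) = (q + 1) * int (card V) - 2 * int (card E)"
proof -
  have "(\<Sum>v\<in>V. int (card (nbrs v))) = 2 * int (card E)"
    using handshake by (metis of_nat_mult of_nat_numeral of_nat_sum)
  then show ?thesis by (simp add: deficiency_def sum_subtractf)
qed

text \<open>This is \<open>two_paths_le\<close> rewritten: \<open>d(u) - 1\<close> is
  \<open>q\<close> minus the deficiency of \<open>u\<close>, and
  \<open>card V - 1 = q * (q + 1) - r\<close>.\<close>

lemma nbrs_deficiency_ge:
  assumes "v \<in> V" and n: "int (card V) = q\<^sup>2 + q + 1 - r"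
  shows "(\<Sum>u\<in>nbrs v. real_of_int (deficiency q u)) \<ge> of_int r - of_int q * of_int (deficiency q v)"
proof -
  have "real (card V) = (of_int q)\<^sup>2 + of_int q + 1 - of_int r"
    using arg_cong[OF n, of real_of_int] by simp
  moreover have "(\<Sum>u\<in>nbrs v. real_of_int (deficiency q u))
      = real (card (nbrs v)) * of_int q - (\<Sum>u\<in>nbrs v. real (card (nbrs u)) - 1)"
    by (simp add: deficiency_def sum_subtractf sum.distrib algebra_simps)
  ultimately show ?thesis
    using two_paths_le[OF assms(1)] by (simp add: deficiency_def algebra_simps power2_eq_square)
qed

end

section \<open>The numerical contradiction\<close>

text \<open>In the notation above, \<open>b = card B\<close>, \<open>m = n - card B\<close>, \<open>S = \<Sum>\<delta>\<close>, \<open>D = \<Sum>x\<close>,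
  \<open>W = \<Sum>w\<^sup>2\<close> and \<open>Q = \<Sum>x\<^sup>2\<close>.\<close>

lemma deficiency_arith:
  fixes q r S D W Q b m :: real
  assumes r: "100 \<le> r" "100 * r \<le> q"
    and S_le: "S \<le> 84 / 100 * r * q + q" and "0 \<le> S"
    and size: "b + m \<ge> q\<^sup>2" and m_le: "r * m \<le> q * S"
    and b_le: "b \<le> S + D" and DQ: "0 \<le> D" "D \<le> Q" and "D\<^sup>2 \<le> m * Q"
    and W_le: "W + Q \<le> (2 * q + 1) * S - (b + m) * r"
    and Q_le: "q\<^sup>2 * Q \<le> (S + D)\<^sup>2 + q * W"
  shows False
proof -
  have q: "q \<ge> 10000" using r by linarith
  \<comment> \<open>As \<open>r \<ge> 100\<close>, the linear term \<open>q\<close> costs at most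
    \<open>1 / 100 * r * q\<close>.\<close>
  have S1: "S \<le> 85 / 100 * r * q"
  proof -
    have "100 * q \<le> r * q" using r q by (intro mult_right_mono) auto
    then show ?thesis using S_le by linarith
  qed
  have rq: "r * q \<le> 1 / 100 * q\<^sup>2"
    using mult_right_mono[OF r(2), of q] q by (simp add: power2_eq_square)
  have S2: "S \<le> 85 / 10000 * q\<^sup>2" using S1 rq by linarith
  \<comment> \<open>With \<open>size\<close> this forces
    \<open>b \<ge> 15 / 100 * q\<^sup>2\<close>, which the final step refutes.\<close>
  have m: "m \<le> 85 / 100 * q\<^sup>2"
  proof -
    have "r * m \<le> q * (85 / 100 * r * q)"
      using m_le S1 q by (smt (verit) mult_left_mono)
    then have "r * m \<le> r * (85 / 100 * q\<^sup>2)" by (simp add: power2_eq_square algebra_simps)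
    then show ?thesis using r by simp
  qed
  \<comment> \<open>The main coefficient is \<open>2 * 85 / 100 - 1 = 70 / 100\<close>; the
    remaining \<open>85 / 100 * r * q\<close> adds at most \<open>1 / 100\<close>, as
    \<open>q \<ge> 85\<close>.\<close>
  have W: "W \<le> 71 / 100 * r * q\<^sup>2"
  proof -
    have "(2 * q + 1) * S \<le> (2 * q + 1) * (85 / 100 * r * q)"
      using S1 q by (intro mult_left_mono) auto
    moreover have "r * q\<^sup>2 \<le> (b + m) * r"
      using mult_left_mono[OF size, of r] r by (simp add: mult.commute)
    moreover have "r * q * 85 \<le> r * q * q" using r q by (intro mult_left_mono) auto
    ultimately show ?thesis
      using W_le DQ by (simp add: power2_eq_square algebra_simps)
  qed
  \<comment> \<open>The terms with \<open>D\<close> are charged to \<open>q\<^sup>2 * Q\<close>.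
    Their coefficients sum to \<open>85 / 100 + 2 * 85 / 10000 = 867 / 1000\<close>, so
    \<open>133 / 1000\<close> of the left side of \<open>Q_le\<close> survives.\<close>
  have "D\<^sup>2 \<le> 85 / 100 * (q\<^sup>2 * Q)"
    using \<open>D\<^sup>2 \<le> m * Q\<close> mult_right_mono[OF m, of Q] DQ by simp
  moreover have "S * D \<le> 85 / 10000 * (q\<^sup>2 * Q)"
    using mult_mono[OF S2 DQ(2)] DQ \<open>0 \<le> S\<close> by simp
  moreover have "S\<^sup>2 \<le> 7225 / 100000000 * (q\<^sup>2 * q\<^sup>2)"
    using mult_mono[OF S2 S2] \<open>0 \<le> S\<close> by (simp add: power2_eq_square)
  moreover have "q * W \<le> 71 / 10000 * (q\<^sup>2 * q\<^sup>2)"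
  proof -
    have "q * W \<le> q * (71 / 100 * r * q\<^sup>2)" using W q by (intro mult_left_mono) auto
    also have "\<dots> = 71 / 100 * q\<^sup>2 * (r * q)" by (simp add: algebra_simps)
    also have "\<dots> \<le> 71 / 100 * q\<^sup>2 * (1 / 100 * q\<^sup>2)" using rq by (intro mult_left_mono) auto
    also have "\<dots> = 71 / 10000 * (q\<^sup>2 * q\<^sup>2)" by simp
    finally show ?thesis .
  qed
  moreover have "(S + D)\<^sup>2 = S\<^sup>2 + 2 * (S * D) + D\<^sup>2" by (simp add: power2_sum)
  moreover have "0 \<le> q\<^sup>2 * q\<^sup>2" by simp
  ultimately have "133 / 1000 * (q\<^sup>2 * Q) \<le> 718 / 100000 * (q\<^sup>2 * q\<^sup>2)"
    using Q_le by linarith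
  then have "q\<^sup>2 * (133 / 1000 * Q) \<le> q\<^sup>2 * (718 / 100000 * q\<^sup>2)" by (simp add: mult_ac)
  then have "133 / 1000 * Q \<le> 718 / 100000 * q\<^sup>2" using q by simp
  moreover have "q\<^sup>2 > 0" using q by simp
  \<comment> \<open>Now \<open>Q\<close> is below \<open>55 / 1000 * q\<^sup>2\<close>, so
    \<open>b \<le> S + D \<le> S + Q\<close> stays below \<open>7 / 100 * q\<^sup>2\<close>.\<close>
  ultimately show False using DQ b_le S2 m size by linarith
qed

section \<open>The edge bound for a graph without four-cycles\<close>

context C4_free_graph
begin

lemma card_edges_le:
  fixes q r :: int
  assumes r: "100 \<le> r" "100 * r \<le> q"
    and n: "int (card V) = q\<^sup>2 + q + 1 - r"
  shows "real (card E) \<le>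
    1 / 2 * real_of_int q * (real_of_int q + 1)\<^sup>2 - 92 / 100 * real_of_int r * real_of_int q"
proof (rule ccontr)
  assume many: "\<not> ?thesis"
  define q' where "q' = real_of_int q"
  define r' where "r' = real_of_int r"
  define \<delta> where "\<delta> v = real_of_int (deficiency q v)" for v
  define w where "w v = max (\<delta> v) 0" for v
  define x where "x v = max (- \<delta> v) 0" for v
  define B where "B = {v \<in> V. \<delta> v > 0}"
  define S where "S = (\<Sum>v\<in>V. \<delta> v)"
  define P where "P = (\<Sum>v\<in>V. w v)"
  define D where "D = (\<Sum>v\<in>V. x v)"
  define W where "W = (\<Sum>v\<in>V. (w v)\<^sup>2)"
  define Q where "Q = (\<Sum>v\<in>V. (x v)\<^sup>2)"
  define m where "m = real (card (V - B))"

  have r': "100 \<le> r'" "100 * r' \<le> q'" using r unfolding r'_def q'_def by linarith+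
  have q'_pos: "q' \<ge> 10000" using r' by linarith
  have n': "real (card V) = q'\<^sup>2 + q' + 1 - r'"
    using arg_cong[OF n, of real_of_int] by (simp add: q'_def r'_def)
  have deg: "real (card (nbrs v)) = q' + 1 - \<delta> v" for v
    by (simp add: \<delta>_def q'_def deficiency_def)
  have w_ge0: "w v \<ge> 0" and x_ge0: "x v \<ge> 0" and \<delta>_eq: "\<delta> v = w v - x v" for v
    by (auto simp: w_def x_def)
  have sq: "(\<delta> v)\<^sup>2 = (w v)\<^sup>2 + (x v)\<^sup>2" for v by (simp add: w_def x_def max_def)
  \<comment> \<open>Integrality of deficiencies gives degree at most \<open>q'\<close> on
    \<open>B\<close>, \<open>card B \<le> P\<close> and \<open>D \<le> Q\<close>.\<close>
  have int: "\<delta> v > 0 \<Longrightarrow> \<delta> v \<ge> 1" "\<delta> v < 0 \<Longrightarrow> - \<delta> v \<ge> 1" for v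
    by (simp_all add: \<delta>_def)
  have P_eq: "P = S + D" by (simp add: P_def S_def D_def \<delta>_eq sum_subtractf)
  have BV: "B \<subseteq> V" "finite B" using finite_V by (auto simp: B_def)
  have bm: "real (card B) + m = real (card V)"
    using card_mono[OF finite_V BV(1)] by (simp add: m_def card_Diff_subset BV)
  have nbrs_\<delta>: "(\<Sum>u\<in>nbrs v. \<delta> u) \<ge> r' - q' * \<delta> v" if "v \<in> V" for v
    using nbrs_deficiency_ge[OF that n] by (simp add: \<delta>_def q'_def r'_def)
  have nbrs_w: "(\<Sum>u\<in>nbrs v. w u) \<ge> r' + q' * x v" if "v \<in> V - B" for v
  proof -
    have "x v = - \<delta> v" using that by (auto simp: B_def x_def max_def)
    moreover have "(\<Sum>u\<in>nbrs v. \<delta> u) \<le> (\<Sum>u\<in>nbrs v. w u)"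
      by (intro sum_mono) (simp add: w_def)
    ultimately show ?thesis using nbrs_\<delta>[of v] that by auto
  qed
  have x_B: "x v = 0" if "v \<in> B" for v using that by (simp add: B_def x_def)
  \<comment> \<open>A degree can exceed \<open>q'\<close> only where the deficiency is not positive,
    and there \<open>w\<close> vanishes.\<close>
  have w_deg: "real (card (nbrs v)) * w v \<le> q' * w v"
    "real (card (nbrs v)) * (w v)\<^sup>2 \<le> q' * (w v)\<^sup>2" for v
  proof -
    have "w v = 0 \<or> real (card (nbrs v)) \<le> q'"
      using int(1)[of v] by (auto simp: w_def deg max_def)
    then show "real (card (nbrs v)) * w v \<le> q' * w v"
      "real (card (nbrs v)) * (w v)\<^sup>2 \<le> q' * (w v)\<^sup>2"
      using w_ge0 by (auto intro: mult_right_mono)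
  qed
  have sum_off_B: "(\<Sum>v\<in>V - B. f v) = (\<Sum>v\<in>V. f v)" if "\<And>v. v \<in> B \<Longrightarrow> f v = 0" for f :: "'a \<Rightarrow> real"
    by (rule sum.mono_neutral_left) (use that finite_V BV in auto)

  have S_eq: "S = (q' + 1) * real (card V) - 2 * real (card E)"
    using arg_cong[OF sum_deficiency[of q], of real_of_int] by (simp add: S_def \<delta>_def q'_def)
  \<comment> \<open>Here \<open>(q' + 1) * card V = q' * (q' + 1)\<^sup>2 + (q' + 1) * (1 -
    r')\<close>, and \<open>84 / 100 = 2 * 92 / 100 - 1\<close>.\<close>
  have S_le: "S \<le> 84 / 100 * r' * q' + q'"
    using many r' unfolding S_eq n' q'_def[symmetric] r'_def[symmetric]
    by (simp add: power2_eq_square algebra_simps)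
  \<comment> \<open>Double counting the weight seen from \<open>V - B\<close> puts
    \<open>q' * D\<close> on the left; it cancels against the same term in
    \<open>q' * P = q' * (S + D)\<close>.\<close>
  have m_le: "r' * m \<le> q' * S"
  proof -
    have "r' * m + q' * D = (\<Sum>v\<in>V - B. r' + q' * x v)"
      using sum_off_B[of x] x_B by (simp add: sum.distrib sum_distrib_left[symmetric] m_def D_def)
    also have "\<dots> \<le> (\<Sum>v\<in>V - B. \<Sum>u\<in>nbrs v. w u)" by (intro sum_mono nbrs_w)
    also have "\<dots> \<le> (\<Sum>v\<in>V. \<Sum>u\<in>nbrs v. w u)"
      by (intro sum_mono2 finite_V sum_nonneg w_ge0) auto
    also have "\<dots> = (\<Sum>v\<in>V. real (card (nbrs v)) * w v)" by (rule sum_nbrs_eq_degree_sum)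
    also have "\<dots> \<le> (\<Sum>v\<in>V. q' * w v)" by (intro sum_mono w_deg)
    also have "\<dots> = q' * P" by (simp add: P_def sum_distrib_left)
    finally show ?thesis by (simp add: P_eq algebra_simps)
  qed
  \<comment> \<open>Summing \<open>nbrs_\<delta>\<close> over all of \<open>V\<close> counts each
    deficiency with its degree \<open>q' + 1 - \<delta> v\<close>, which brings in the sum of
    squares with a minus sign.\<close>
  have W_le: "W + Q \<le> (2 * q' + 1) * S - (real (card B) + m) * r'"
  proof -
    have "real (card V) * r' - q' * S = (\<Sum>v\<in>V. r' - q' * \<delta> v)"
      by (simp add: sum_subtractf S_def sum_distrib_left)
    also have "\<dots> \<le> (\<Sum>v\<in>V. \<Sum>u\<in>nbrs v. \<delta> u)" by (intro sum_mono nbrs_\<delta>)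
    also have "\<dots> = (\<Sum>v\<in>V. real (card (nbrs v)) * \<delta> v)" by (rule sum_nbrs_eq_degree_sum)
    also have "\<dots> = (\<Sum>v\<in>V. (q' + 1) * \<delta> v - ((w v)\<^sup>2 + (x v)\<^sup>2))"
      unfolding sq[symmetric] deg by (simp add: power2_eq_square algebra_simps)
    also have "\<dots> = (q' + 1) * S - (W + Q)"
      by (simp add: sum_subtractf sum.distrib S_def W_def Q_def sum_distrib_left)
    finally show ?thesis unfolding bm by (simp add: algebra_simps)
  qed
  have Q_le: "q'\<^sup>2 * Q \<le> (S + D)\<^sup>2 + q' * W"
  proof -
    have "q'\<^sup>2 * Q = (\<Sum>v\<in>V - B. (q' * x v)\<^sup>2)"
      using sum_off_B[of "\<lambda>v. (x v)\<^sup>2"] x_B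
      by (simp add: Q_def power_mult_distrib sum_distrib_left[symmetric])
    also have "\<dots> \<le> (\<Sum>v\<in>V - B. (\<Sum>u\<in>nbrs v. w u)\<^sup>2)"
    proof (intro sum_mono power_mono)
      fix v assume "v \<in> V - B"
      then show "q' * x v \<le> (\<Sum>u\<in>nbrs v. w u)" using nbrs_w[of v] r' by linarith
      show "0 \<le> q' * x v" using q'_pos x_ge0[of v] by simp
    qed
    also have "\<dots> \<le> (\<Sum>v\<in>V. (\<Sum>u\<in>nbrs v. w u)\<^sup>2)"
      by (intro sum_mono2 finite_V) auto
    also have "\<dots> \<le> P\<^sup>2 + (\<Sum>v\<in>V. real (card (nbrs v)) * (w v)\<^sup>2)"
      unfolding P_def by (rule second_moment_le) (rule w_ge0)
    also have "\<dots> \<le> P\<^sup>2 + (\<Sum>v\<in>V. q' * (w v)\<^sup>2)" by (intro add_left_mono sum_mono w_deg)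
    finally show ?thesis by (simp add: P_eq W_def sum_distrib_left)
  qed
  \<comment> \<open>Restricting to \<open>V - B\<close>, where \<open>x\<close> is supported, gives
    the factor \<open>m\<close> instead of \<open>card V\<close>; this keeps the coefficient of
    \<open>q'\<^sup>2 * Q\<close> below one.\<close>
  have CS: "D\<^sup>2 \<le> m * Q"
  proof -
    have "D\<^sup>2 = (\<Sum>v\<in>V - B. 1 * x v)\<^sup>2" using sum_off_B[of x] x_B by (simp add: D_def)
    also have "\<dots> \<le> (\<Sum>v\<in>V - B. 1\<^sup>2) * (\<Sum>v\<in>V - B. (x v)\<^sup>2)" by (rule Cauchy_Schwarz_ineq_sum)
    also have "\<dots> = m * Q" using sum_off_B[of "\<lambda>v. (x v)\<^sup>2"] x_B by (simp add: m_def Q_def)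
    finally show ?thesis .
  qed
  have "D \<le> Q"
    unfolding D_def Q_def
  proof (rule sum_mono)
    fix v
    have "x v = 0 \<or> x v \<ge> 1" using int(2)[of v] by (auto simp: x_def max_def)
    then show "x v \<le> (x v)\<^sup>2" using self_le_power[of "x v" 2] by auto
  qed
  moreover have "0 \<le> D" unfolding D_def by (intro sum_nonneg x_ge0)
  moreover have "real (card B) \<le> S + D"
  proof -
    have "real (card B) = (\<Sum>v\<in>B. 1)" by simp
    also have "\<dots> \<le> (\<Sum>v\<in>B. w v)"
      by (intro sum_mono) (use int(1) in \<open>force simp: B_def w_def\<close>)
    also have "\<dots> \<le> P" unfolding P_def by (intro sum_mono2 finite_V BV w_ge0)
    finally show ?thesis by (simp add: P_eq)
  qed
  moreover have "0 \<le> S"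
  proof -
    \<comment> \<open>The left side of \<open>m_le\<close> is nonnegative.\<close>
    have "0 \<le> q' * S" using m_le r' by (smt (verit) m_def mult_nonneg_nonneg of_nat_0_le_iff)
    then show ?thesis using q'_pos by (simp add: zero_le_mult_iff)
  qed
  moreover have "real (card B) + m \<ge> q'\<^sup>2" using bm n' r' by simp
  ultimately show False
    using deficiency_arith[OF r' S_le _ _ m_le _ _ _ CS W_le Q_le] by blast
qed

end

section \<open>Transfer to the extremal number\<close>

theorem theorem1p3:
  shows "\<exists>R0 :: int. \<forall>(q :: int) (r :: int) (n :: nat).
    q \<ge> 1 \<longrightarrow> R0 \<le> r \<longrightarrow> real_of_int r \<le> 0.01 * real_of_int q \<longrightarrow>
    int n = q\<^sup>2 + q + 1 - r \<longrightarrow>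
      int n \<in> {q\<^sup>2 + 1 .. q\<^sup>2 + q} \<and>
      real (ex_C4 n) \<le>
        1 / 2 * real_of_int q * (real_of_int q + 1)\<^sup>2 - 0.92 * real_of_int r * real_of_int q"
\<comment> \<open>The threshold 100 is what lets \<open>r * q / 100\<close> absorb the linear term
  \<open>q\<close> in the bound on the total deficiency.\<close>
proof (intro exI[of _ 100] allI impI)
  fix q r :: int and n :: nat
  assume r: "100 \<le> r" "real_of_int r \<le> 0.01 * real_of_int q" and n: "int n = q\<^sup>2 + q + 1 - r"
  obtain V :: "nat set" and E where G: "simple_graph V E" "card V = n" "\<not> contains_C4 E"
    "card E = ex_C4 n"
    using ex_C4_attained by blast
  interpret C4_free_graph V E by unfold_locales (fact G)+
  from r have r': "100 * r \<le> q" by simp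
  have "real (ex_C4 n) \<le>
    1 / 2 * real_of_int q * (real_of_int q + 1)\<^sup>2 - 0.92 * real_of_int r * real_of_int q"
    using card_edges_le[OF r(1) r'] G n by simp
  moreover have "r \<le> q" using r(1) r' by linarith
  ultimately show "int n \<in> {q\<^sup>2 + 1 .. q\<^sup>2 + q} \<and> real (ex_C4 n) \<le>
    1 / 2 * real_of_int q * (real_of_int q + 1)\<^sup>2 - 0.92 * real_of_int r * real_of_int q"
    using n r by simp
qed

end
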